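(* Let $q$ be a power of $2$, and let $L_0$ and $L_1$ be $2$-linear polynomials over $\mathbb F_{q^2}$. Then $L_1(x^{q+1})+L_0(x^2)$ is a permutation polynomial of $\mathbb F_{q^2}$ if and only if $L_1(x^q+x)=0$ (as a map on $\mathbb F_{q^2}$, i.e. $L_1(v^q+v)=0$ for every $v\in\mathbb F_{q^2}$) and $\ker L_0=\{0\}$.
   Context: A $2$-linear polynomial over $\mathbb F_{q^2}$ is a polynomial of the form $\sum_i a_ix^{2^i}$ with $a_i\in\mathbb F_{q^2}$. Polynomials over $\mathbb F_{q^2}$ are identified with the maps they induce on $\mathbb F_{q^2}$ (that is, one sets $x^{q^2}=x$), and $\ker L_0=\{v\in\mathbb F_{q^2}:L_0(v)=0\}$. A permutation polynomial of $\mathbb F_{q^2}$ is a polynomial over $\mathbb F_{q^2}$ whose induced map on $\mathbb F_{q^2}$ is a bijection. *)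

theory Defs
  imports "HOL-Computational_Algebra.Polynomial" "HOL-Library.Cardinality"
begin

definition two_linear_poly :: "'a::comm_semiring_1 poly \<Rightarrow> bool" where
  "two_linear_poly L \<longleftrightarrow> (\<exists>(N::nat) (a :: nat \<Rightarrow> 'a). L = (\<Sum>i<N. monom (a i) (2 ^ i)))"

definition permutation_poly :: "'a::comm_semiring_1 poly \<Rightarrow> bool" where
  "permutation_poly p \<longleftrightarrow> bij (poly p)"

definition poly_kernel :: "'a::comm_semiring_1 poly \<Rightarrow> 'a set" where
  "poly_kernel L = {v. poly L v = 0}"

end

theory Submission
  imports Defs
begin

text \<open>
  Write \<open>f(x) = L\<^sub>1(x\<^bsup>q+1\<^esup>) + L\<^sub>0(x\<^sup>2)\<close> and \<open>Tr(y) = y\<^sup>q + y\<close>, which maps onto the subfield of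
  elements with \<open>y\<^sup>q = y\<close>. In characteristic 2,
  \<open>f(x + a) - f(x) = L\<^sub>0(a\<^sup>2) + L\<^sub>1(Tr(x a\<^sup>q) + a\<^bsup>q+1\<^esup>)\<close>.
  For \<open>a \<noteq> 0\<close> the argument of \<open>L\<^sub>1\<close> takes every value in the image of \<open>Tr\<close> as \<open>x\<close> varies. Hence if
  \<open>f\<close> is injective, \<open>L\<^sub>0(b) = L\<^sub>1(Tr v)\<close> forces \<open>b = 0\<close>; taking \<open>v = 0\<close> shows that \<open>L\<^sub>0\<close> is
  injective, hence surjective, so that every \<open>L\<^sub>1(Tr v)\<close> has the form \<open>L\<^sub>0(b)\<close> and therefore vanishes.
  Conversely, \<open>x\<^bsup>q+1\<^esup>\<close> lies in the image of \<open>Tr\<close>, so \<open>f(x) = L\<^sub>0(x\<^sup>2)\<close> when \<open>L\<^sub>1\<close> vanishes there.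
\<close>

text \<open>Multiplication by a nonzero \<open>x\<close> permutes the nonzero elements, so their
  product absorbs a factor \<open>x ^ (CARD('a) - 1)\<close>.\<close>

lemma finite_field_power_card:
  fixes x :: "'a :: {field, finite}"
  shows "x ^ CARD('a) = x"
proof (cases "x = 0")
  case False
  let ?U = "UNIV - {0 :: 'a}"
  have "\<Prod>?U = (\<Prod>y\<in>?U. x * y)"
    by (rule prod.reindex_bij_witness[where i = "\<lambda>y. x * y" and j = "\<lambda>y. y / x"])
      (use False in auto)
  also have "\<dots> = x ^ (CARD('a) - 1) * \<Prod>?U"
    by (simp add: prod.distrib)
  finally have "x ^ (CARD('a) - 1) * \<Prod>?U = 1 * \<Prod>?U"
    by simp
  moreover have "\<Prod>?U \<noteq> 0"
    by simp
  ultimately have "x ^ (CARD('a) - 1) = 1"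
    unfolding mult_cancel_right by blast
  then have "x * x ^ (CARD('a) - 1) = x"
    by simp
  then show ?thesis
    by (simp flip: power_Suc)
qed simp

text \<open>Translation by 1 permutes the field, so comparing the sums of all elements gives
  \<open>of_nat CARD('a) = 0\<close>.\<close>

lemma CHAR_eq_2_of_card:
  assumes "CARD('a :: {field, finite}) = 2 ^ n"
  shows "CHAR('a) = 2"
proof -
  have "(\<Sum>x\<in>(UNIV :: 'a set). x) = (\<Sum>x\<in>UNIV. x + 1)"
    by (rule sum.reindex_bij_witness[where i = "\<lambda>y. y + 1" and j = "\<lambda>y. y - 1"]) simp_all
  then have "of_nat CARD('a) = (0 :: 'a)"
    by (simp add: sum.distrib)
  then have "of_nat 2 = (0 :: 'a)"
    by (simp add: assms)
  then have "CHAR('a) dvd 2"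
    by (simp only: of_nat_eq_0_iff_char_dvd)
  then show ?thesis
    using CHAR_not_1'[where 'a = 'a] two_is_prime_nat by (auto simp: prime_nat_iff)
qed

lemma two_linear_poly_add:
  fixes L :: "'a :: field poly"
  assumes "CHAR('a) = 2" "two_linear_poly L"
  shows "poly L (x + y) = poly L x + poly L y"
proof -
  obtain N a where L: "L = (\<Sum>i<N. monom (a i) (2 ^ i))"
    using assms(2) unfolding two_linear_poly_def by blast
  have "(x + y) ^ (2 ^ i) = x ^ (2 ^ i) + y ^ (2 ^ i)" for i
    by (rule freshmans_dream'[where n = i]) (simp_all add: assms(1))
  then show ?thesis
    by (simp add: L poly_sum poly_monom distrib_left sum.distrib)
qed

lemma inj_additive_iff:
  fixes f :: "'a :: ab_group_add \<Rightarrow> 'b :: ab_group_add"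
  assumes "\<And>x y. f (x + y) = f x + f y"
  shows "inj f \<longleftrightarrow> (\<forall>x. f x = 0 \<longrightarrow> x = 0)"
proof -
  interpret additive f by standard (rule assms)
  show ?thesis
    unfolding inj_def by (metis diff zero right_minus_eq)
qed

text \<open>If \<open>t = \<theta>\<^sup>q + \<theta>\<close> is nonzero, then \<open>u\<theta>/t\<close> has trace \<open>u\<close>.\<close>

lemma trace_surj:
  fixes u :: "'a :: {field, finite}"
  assumes "CHAR('a) = 2" "q = 2 ^ m" "CARD('a) = q ^ 2" "u ^ q = u"
  obtains v where "v ^ q + v = u"
proof -
  have q1: "q > 1"
  proof -
    have "card {0, 1 :: 'a} \<le> CARD('a)"
      by (rule card_mono) simp_all
    then show ?thesis
      using assms(3) by (cases "q \<le> 1") (auto simp: le_Suc_eq)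
  qed
  \<comment> \<open>\<open>?p\<close> has at most \<open>q < q ^ 2\<close> roots, so some
    \<open>\<theta>\<close> has nonzero trace.\<close>
  let ?p = "monom 1 q + monom 1 1 :: 'a poly"
  have "coeff ?p q = 1"
    using q1 by simp
  then have "?p \<noteq> 0"
    by (metis coeff_0 zero_neq_one)
  then have "card {x. poly ?p x = 0} \<le> degree ?p"
    by (rule card_poly_roots_bound)
  also have "\<dots> \<le> q"
    by (intro degree_add_le order.trans[OF degree_monom_le]) (use q1 in auto)
  also have "\<dots> < CARD('a)"
    using q1 assms(3) by (simp add: power2_eq_square)
  finally have "{x. poly ?p x = 0} \<noteq> UNIV"
    by force
  then obtain \<theta> where "poly ?p \<theta> \<noteq> 0"
    by blast
  then have \<theta>: "\<theta> ^ q + \<theta> \<noteq> 0"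
    by (simp add: poly_monom)
  define t where "t = \<theta> ^ q + \<theta>"
  \<comment> \<open>Once \<open>t\<close> is fixed by the \<open>q\<close>-th power, division by
    \<open>t\<close> commutes with the trace.\<close>
  have "t ^ q = (\<theta> ^ q) ^ q + \<theta> ^ q"
    unfolding t_def by (rule freshmans_dream'[where n = m]) (simp_all add: assms)
  also have "(\<theta> ^ q) ^ q = \<theta>"
    using finite_field_power_card[of \<theta>]
    by (simp add: assms(3) power2_eq_square flip: power_mult)
  finally have "t ^ q = t"
    by (simp add: t_def add.commute)
  then have "(u * \<theta> / t) ^ q + u * \<theta> / t = u * (\<theta> ^ q + \<theta>) / t"
    by (simp add: power_mult_distrib power_divide assms(4) add_divide_distrib distrib_left)
  also have "\<dots> = u"
    using \<theta> by (simp add: t_def)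
  finally show ?thesis
    by (rule that)
qed

theorem theorem6:
  fixes q m :: nat
    and L0 L1 :: "'a :: {field, finite} poly"
  assumes "q = 2 ^ m"
    and "CARD('a) = q ^ 2"
    and "two_linear_poly L0"
    and "two_linear_poly L1"
  shows "permutation_poly (pcompose L1 (monom 1 (q + 1)) + pcompose L0 (monom 1 2)) \<longleftrightarrow>
         (\<forall>v. poly L1 (v ^ q + v) = 0) \<and> poly_kernel L0 = {0}"
proof -
  have char: "CHAR('a) = 2"
    by (rule CHAR_eq_2_of_card[where n = "m * 2"]) (simp add: assms(1,2) power_mult)
  note add0 = two_linear_poly_add[OF char assms(3)]
  note add1 = two_linear_poly_add[OF char assms(4)]
  have add_self: "x + x = 0" for x :: 'a
    using uminus_CHAR_2[OF char, of x] by (simp add: add_eq_0_iff2)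
  have addq: "(x + y) ^ q = x ^ q + y ^ q" for x y :: 'a
    by (rule freshmans_dream'[where n = m]) (simp_all add: char assms(1))
  have add2: "(x + y) ^ 2 = x ^ 2 + y ^ 2" for x y :: 'a
    by (rule freshmans_dream) (simp_all add: char)
  have qq: "(x ^ q) ^ q = x" for x :: 'a
    using finite_field_power_card[of x]
    by (simp add: assms(2) power2_eq_square flip: power_mult)
  note trace = trace_surj[OF char assms(1,2)]
  have L0_0: "poly L0 0 = 0" and L1_0: "poly L1 0 = 0"
    using add0[of 0 0] add1[of 0 0] by (simp_all only: add_0_right add_cancel_right_right)
  have ker0: "poly_kernel L0 = {0} \<longleftrightarrow> inj (poly L0)"
    unfolding inj_additive_iff[of "poly L0", OF add0] poly_kernel_def using L0_0 by auto
  define f where "f = poly (pcompose L1 (monom 1 (q + 1)) + pcompose L0 (monom 1 2))"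
  have f: "f x = poly L1 (x ^ q * x) + poly L0 (x ^ 2)" for x
    by (simp add: f_def poly_pcompose poly_monom mult.commute)
  have norm_fixed: "(x ^ q * x) ^ q = x ^ q * x" for x :: 'a
    by (simp add: power_mult_distrib qq mult.commute)
  have inj_square: "inj (\<lambda>a :: 'a. a ^ 2)"
    using inj_additive_iff[of "\<lambda>a :: 'a. a ^ 2", OF add2] by simp
  have square: "\<exists>a. a ^ 2 = b" for b :: 'a
  proof -
    have "surj (\<lambda>a :: 'a. a ^ 2)"
      by (rule finite_UNIV_inj_surj[OF finite_class.finite_UNIV inj_square])
    then show ?thesis
      by (metis surjD)
  qed
  \<comment> \<open>Since \<open>(a ^ q) ^ q = a\<close>, the cross terms
    \<open>x ^ q * a + x * a ^ q\<close> form the trace of \<open>x * a ^ q\<close>.\<close>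
  have shift: "f (x + a) = f x + (poly L0 (a ^ 2) + poly L1 ((x * a ^ q) ^ q + x * a ^ q + a ^ q * a))"
    for x a
    unfolding f addq add2 power_mult_distrib qq distrib_left distrib_right add0 add1
    by (simp add: algebra_simps)
  have "(\<forall>v. poly L1 (v ^ q + v) = 0) \<and> inj (poly L0)" if inj: "inj f"
  proof -
    have sep: "b = 0" if eq: "poly L0 b = poly L1 (v ^ q + v)" for b v
    proof (rule ccontr)
      assume "b \<noteq> 0"
      obtain a where a: "a ^ 2 = b"
        using square by blast
      then have "a \<noteq> 0"
        using \<open>b \<noteq> 0\<close> by auto
      obtain w where w: "w ^ q + w = a ^ q * a"
        using trace[OF norm_fixed] by blast
      \<comment> \<open>\<open>w\<close> has trace \<open>a ^ q * a\<close>, so with this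
        \<open>x\<close> the norm of \<open>a\<close> occurs twice in the argument of
        \<open>L1\<close> and cancels, leaving \<open>v ^ q + v\<close>.\<close>
      define x where "x = (v + w) / a ^ q"
      have x: "x * a ^ q = v + w"
        using \<open>a \<noteq> 0\<close> by (simp add: x_def)
      have "(x * a ^ q) ^ q + x * a ^ q + a ^ q * a = (v ^ q + v) + (a ^ q * a + a ^ q * a)"
        unfolding x addq w[symmetric] by (simp add: algebra_simps)
      then have "f (x + a) = f x"
        unfolding shift a eq by (simp add: add_self)
      with inj have "x + a = x"
        by (rule injD)
      then show False
        using \<open>a \<noteq> 0\<close> by simp
    qed
    have inj0: "inj (poly L0)"
      \<comment> \<open>The case \<open>v = 0\<close>; here \<open>q > 0\<close> gives
        \<open>0 ^ q = 0\<close>.\<close>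
      using sep[of _ 0] by (simp add: assms(1) zero_power inj_additive_iff[of "poly L0", OF add0] L1_0)
    then have "surj (poly L0)"
      by (simp add: finite_UNIV_inj_surj)
    then have "poly L1 (v ^ q + v) = 0" for v
      using sep L0_0 by (metis surjD)
    then show ?thesis
      using inj0 by blast
  qed
  moreover have "inj f" if L1: "\<forall>v. poly L1 (v ^ q + v) = 0" and inj0: "inj (poly L0)"
  proof -
    have "poly L1 (x ^ q * x) = 0" for x
      using trace[OF norm_fixed] L1 by metis
    then have "f = (\<lambda>x. poly L0 (x ^ 2))"
      by (simp add: f fun_eq_iff)
    then show ?thesis
      using inj_compose[OF inj0 inj_square] by (simp add: comp_def)
  qed
  moreover have "bij f \<longleftrightarrow> inj f"
    by (auto simp: bij_def finite_UNIV_inj_surj)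
  ultimately show ?thesis
    unfolding permutation_poly_def ker0 f_def[symmetric] by blast
qed

end
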